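(* Assume $B\to\infty$ and $R\to0$ with $R\ll 1/\sqrt B$. Let $h>0$ be of order one (a fixed constant) and let $\Omega_h\subset\Omega_\nu(L)$ denote the set of all configurations $\omega$ such that there exists a solution $\Gamma(\omega,\lambda,\theta)$ satisfying $\max_j|\xi_j^{(2)}-v_1L|\geq h$, where the maximum is over the centers $\xi_j=(\xi_j^{(1)},\xi_j^{(2)})$ of the grains connected by $\Gamma(\omega,\lambda,\theta)$. Then, if $\sqrt B\ll L\ll\sqrt B\log B$ as $B\to\infty$, one has $\mu_\nu(\Omega_h)\to0$ as $B\to\infty$.
   Context: Setting. All lengths are non-dimensional. Let $L>0$, $B>0$ (Bond number), $R\in(0,1/2)$ (grain radius), $\nu>0$ (density), with $N=\nu L^2$ a positive integer. The container is $[0,L]^2$, with points $x=(x_1,x_2)$; gravity points in direction $-\mathbf e_2$. A configuration is $\omega=(\xi_1,\dots,\xi_N)\in\Omega_\nu(L)=([0,L]^2)^{\nu L^2}$; the grains are the discs $B_R(\xi_j)$ (overlaps allowed). $\mu_\nu$ is the uniform probability measure on the Borel sets of $\Omega_\nu(L)$: $\mu_\nu(d\xi)=L^{-2\nu L^2}\prod_{k=1}^{\nu L^2}d\xi_k$. The liquid volume fraction $v_0\in[0,1]$ is fixed; $v_1$ is the volume fraction below the interface $\Gamma$ including grains, $v_1L^2\approx v_0L^2+n\pi R^2$ where $n$ is the number of grains below $\Gamma$. Put $\lambda=v_1L$ and $\theta=L\max\{1/\sqrt B,R\}$. Interfaces. An interface $\Gamma(\omega,\lambda,\theta)$ is a union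 of non-intersecting oriented curves (elemental components) joining pairs of grains or a grain/wall and a wall; it connects $\{x_1=0\}$ to $\{x_1=L\}$, has no self-intersections and splits the domain into two regions (liquid and air, no isolated bubbles). Each elemental component solves the capillary equation $H=B(x_2-\lambda)$, where $H=\beta'(s)$ is the signed curvature, $s$ is arc-length and $\beta\in[-\pi,\pi]$ is the angle from $\mathbf e_1$ to the tangent $\mathbf t$; the unit normal $\mathbf n$ with $\det(\mathbf t,\mathbf n)=1$ points into the air. At grains and walls Young's condition holds with one contact angle $\alpha\in[-\pi/2,\pi/2]$: if $\mathbf N$ is the outer normal of $\partial B_R(\xi)$ at a contact point and $\mathbf t_c$ is the tangent there, then $\mathbf N\wedge\mathbf t_c=\sin(\alpha)\,\mathbf e_3$ if $\mathbf N\cdot\mathbf t_c\ge0$, and $\mathbf N\wedge\mathbf t_c=\sin(\alpha-\pi)\,\mathbf e_3$ if $\mathbf N\cdot\mathbf t_c<0$, where $\mathbf e_3=\mathbf e_1\wedge\mathbf e_2$. A grain is connected by $\Gamma$ if an elemental component of $\Gamma$ ends on it with Young's condition. Notation: $f\ll g$ means $f/g\to0$. *)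

theory Defs
  imports "HOL-Analysis.Analysis"
begin

type_synonym point = "real \<times> real"
type_synonym config = "nat \<Rightarrow> point"

definition container :: "real \<Rightarrow> point set" where
  "container L = {0..L} \<times> {0..L}"

definition configs :: "nat \<Rightarrow> real \<Rightarrow> config set" where
  "configs N L = (\<Pi>\<^sub>E j\<in>{..<N}. container L)"

definition config_measure :: "nat \<Rightarrow> real \<Rightarrow> config measure" where
  "config_measure N L = uniform_measure (\<Pi>\<^sub>M j\<in>{..<N}. lborel) (configs N L)"

text \<open>The third coordinate of the cross product, i.e. \<open>det (u, v)\<close>.\<close>

definition wedge :: "point \<Rightarrow> point \<Rightarrow> real" where
  "wedge u v = fst u * snd v - snd u * fst v"

definition unit_vec :: "real \<Rightarrow> point" where
  "unit_vec b = (cos b, sin b)"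

definition young :: "real \<Rightarrow> point \<Rightarrow> point \<Rightarrow> bool" where
  "young \<alpha> \<nu> t \<longleftrightarrow> wedge \<nu> t = (if \<nu> \<bullet> t \<ge> 0 then sin \<alpha> else sin (\<alpha> - pi))"

datatype site = Grain nat | Left_Wall | Right_Wall

text \<open>
  An elemental component is given by the sites it joins, its length, its arc-length
  parametrization and the angle from the first basis vector to the tangent.
  The two functions are relevant on \<open>{0..arc_length c}\<close> only.
\<close>

record elemental =
  source :: site
  target :: site
  arc_length :: real
  curve :: "real \<Rightarrow> point"
  angle :: "real \<Rightarrow> real"

definition trace :: "elemental \<Rightarrow> point set" where
  "trace c = curve c ` {0..arc_length c}"

text \<open>
  The normals used in the contact conditions point out of the solid: out of the disc at a
  grain, into the container at a wall.
\<close>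

fun contact :: "real \<Rightarrow> real \<Rightarrow> real \<Rightarrow> nat \<Rightarrow> config \<Rightarrow> site \<Rightarrow> point \<Rightarrow> point \<Rightarrow> bool" where
  "contact R L \<alpha> N \<omega> (Grain j) p t \<longleftrightarrow>
     j < N \<and> dist p (\<omega> j) = R \<and> young \<alpha> ((1 / R) *\<^sub>R (p - \<omega> j)) t"
| "contact R L \<alpha> N \<omega> Left_Wall p t \<longleftrightarrow> fst p = 0 \<and> young \<alpha> (1, 0) t"
| "contact R L \<alpha> N \<omega> Right_Wall p t \<longleftrightarrow> fst p = L \<and> young \<alpha> (-1, 0) t"

definition is_elemental ::
  "real \<Rightarrow> real \<Rightarrow> real \<Rightarrow> real \<Rightarrow> nat \<Rightarrow> config \<Rightarrow> real \<Rightarrow> elemental \<Rightarrow> bool" where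
  "is_elemental B R L \<alpha> N \<omega> lam c \<longleftrightarrow>
     source c \<noteq> target c \<and> arc_length c > 0 \<and>
     trace c \<subseteq> container L \<and> inj_on (curve c) {0..arc_length c} \<and>
     (\<forall>s\<in>{0..arc_length c}.
        angle c s \<in> {-pi..pi} \<and>
        (curve c has_vector_derivative unit_vec (angle c s)) (at s within {0..arc_length c}) \<and>
        (angle c has_real_derivative B * (snd (curve c s) - lam)) (at s within {0..arc_length c})) \<and>
     contact R L \<alpha> N \<omega> (source c) (curve c 0) (unit_vec (angle c 0)) \<and>
     contact R L \<alpha> N \<omega> (target c) (curve c (arc_length c)) (unit_vec (angle c (arc_length c)))"

text \<open>
  The elemental components are listed in the order in which they are met on the way from
  the left to the right wall. With this orientation the left normal points upwards on
  average, so that the air lies above the interface and the liquid below it.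
\<close>

record interface =
  pieces :: "elemental list"
  liquid :: "point set"
  air :: "point set"

definition connected_grains :: "interface \<Rightarrow> nat set" where
  "connected_grains \<Gamma> = {j. \<exists>c\<in>set (pieces \<Gamma>). source c = Grain j \<or> target c = Grain j}"

text \<open>
  The curves alone leave gaps at the grains they are attached to. It is their union with
  the connected discs that separates the liquid from the air; grains that are not connected
  take no part in this and are not subject to any condition.
\<close>

definition barrier :: "real \<Rightarrow> config \<Rightarrow> interface \<Rightarrow> point set" where
  "barrier R \<omega> \<Gamma> =
     (\<Union>c\<in>set (pieces \<Gamma>). trace c) \<union> (\<Union>j\<in>connected_grains \<Gamma>. cball (\<omega> j) R)"

text \<open>
  \<open>is_interface B R L \<alpha> N \<omega> lam \<Gamma>\<close>: \<open>\<Gamma>\<close> is an interface \<open>\<Gamma>(\<omega>, \<lambda>, \<theta>)\<close> with \<open>\<lambda> = lam\<close>.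
  The scale \<open>\<theta> = L max {1 / sqrt B, R}\<close> is determined by \<open>B\<close>, \<open>R\<close>, \<open>L\<close> and is no separate
  argument. The vector \<open>unit_vec (angle c s + pi / 2)\<close> is the unit normal
  \<open>n\<close> with \<open>det (t, n) = 1\<close>. That there are no bubbles is expressed by \<open>liquid \<Gamma>\<close> and
  \<open>air \<Gamma>\<close> being the only connected components of the complement.
\<close>

definition is_interface ::
  "real \<Rightarrow> real \<Rightarrow> real \<Rightarrow> real \<Rightarrow> nat \<Rightarrow> config \<Rightarrow> real \<Rightarrow> interface \<Rightarrow> bool" where
  "is_interface B R L \<alpha> N \<omega> lam \<Gamma> \<longleftrightarrow>
     pieces \<Gamma> \<noteq> [] \<and>
     (\<forall>c\<in>set (pieces \<Gamma>). is_elemental B R L \<alpha> N \<omega> lam c) \<and>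
     source (hd (pieces \<Gamma>)) = Left_Wall \<and>
     target (last (pieces \<Gamma>)) = Right_Wall \<and>
     successively (\<lambda>c d. \<exists>j. target c = Grain j \<and> source d = Grain j) (pieces \<Gamma>) \<and>
     (\<forall>i<length (pieces \<Gamma>). \<forall>k<length (pieces \<Gamma>).
        i \<noteq> k \<longrightarrow> trace (pieces \<Gamma> ! i) \<inter> trace (pieces \<Gamma> ! k) = {}) \<and>
     liquid \<Gamma> \<noteq> air \<Gamma> \<and>
     components (container L - barrier R \<omega> \<Gamma>) = {liquid \<Gamma>, air \<Gamma>} \<and>
     (\<forall>c\<in>set (pieces \<Gamma>). \<forall>s\<in>{0<..<arc_length c}.
        \<forall>\<^sub>F \<epsilon> in at_right 0.
          curve c s + \<epsilon> *\<^sub>R unit_vec (angle c s + pi / 2) \<in> air \<Gamma> \<and>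
          curve c s - \<epsilon> *\<^sub>R unit_vec (angle c s + pi / 2) \<in> liquid \<Gamma>)"

definition grains_below :: "nat \<Rightarrow> config \<Rightarrow> interface \<Rightarrow> nat" where
  "grains_below N \<omega> \<Gamma> = card {j. j < N \<and> \<omega> j \<in> liquid \<Gamma>}"

text \<open>
  The volume fraction \<open>v1\<close> below the interface, grains included, depends on the configuration
  and on the interface; an interface has to be a solution for its own value of \<open>\<lambda> = v1 L\<close>.
  Borel measurability of \<open>high_configs\<close> is not evident and \<open>emeasure\<close> is \<open>0\<close> by convention on
  non-measurable sets, hence its size is to be measured by \<open>outer_measure_of\<close>.
\<close>

definition high_configs ::
  "real \<Rightarrow> real \<Rightarrow> real \<Rightarrow> real \<Rightarrow> nat \<Rightarrow> (config \<Rightarrow> interface \<Rightarrow> real) \<Rightarrow> real \<Rightarrow> config set" where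
  "high_configs B R L \<alpha> N v1 h =
     {\<omega> \<in> configs N L. \<exists>\<Gamma>. is_interface B R L \<alpha> N \<omega> (v1 \<omega> \<Gamma> * L) \<Gamma> \<and>
        connected_grains \<Gamma> \<noteq> {} \<and>
        Max ((\<lambda>j. \<bar>snd (\<omega> j) - v1 \<omega> \<Gamma> * L\<bar>) ` connected_grains \<Gamma>) \<ge> h}"

text \<open>
  The relation \<open>v1 L\<^sup>2 \<approx> v0 L\<^sup>2 + n \<pi> R\<^sup>2\<close>, read as: the two sides differ by \<open>o(L\<^sup>2)\<close> as
  \<open>B \<rightarrow> \<infinity>\<close>, uniformly in the configuration and in the interface.
\<close>

definition volume_balance ::
  "(real \<Rightarrow> real) \<Rightarrow> (real \<Rightarrow> real) \<Rightarrow> real \<Rightarrow> (real \<Rightarrow> nat) \<Rightarrow> real \<Rightarrow>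
    (real \<Rightarrow> config \<Rightarrow> interface \<Rightarrow> real) \<Rightarrow> bool" where
  "volume_balance R L \<alpha> N v0 v1 \<longleftrightarrow>
     (\<forall>\<epsilon>>0. \<forall>\<^sub>F B in at_top. \<forall>\<omega>\<in>configs (N B) (L B). \<forall>\<Gamma>.
        is_interface B (R B) (L B) \<alpha> (N B) \<omega> (v1 B \<omega> \<Gamma> * L B) \<Gamma> \<longrightarrow>
        \<bar>v1 B \<omega> \<Gamma> * (L B)\<^sup>2 - (v0 * (L B)\<^sup>2 + real (grains_below (N B) \<omega> \<Gamma>) * pi * (R B)\<^sup>2)\<bar>
          \<le> \<epsilon> * (L B)\<^sup>2)"

lemma configs_in_sets: "configs N L \<in> sets (\<Pi>\<^sub>M j\<in>{..<N}. lborel)"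
  unfolding configs_def container_def
  by (intro sets_PiM_I_finite) (auto simp: borel_closed closed_Times)

lemma emeasure_config_measure_space:
  assumes "L > 0"
  shows "emeasure (config_measure N L) (configs N L) = 1"
proof -
  interpret product_sigma_finite "\<lambda>_::nat. lborel :: point measure"
    by standard
  have c: "container L = cbox (0, 0) (L, L)"
    by (auto simp: container_def cbox_Pair_eq)
  have "emeasure lborel (container L) = ennreal (L * L)"
    unfolding c using assms
    by (subst emeasure_lborel_cbox) (auto simp: Basis_prod_def prod.union_disjoint)
  then have "emeasure (\<Pi>\<^sub>M j\<in>{..<N}. lborel) (configs N L) = ennreal ((L * L) ^ N)"
    unfolding configs_def using assms
    by (subst emeasure_PiM) (auto simp: c ennreal_power)
  with assms show ?thesis
    by (simp add: config_measure_def configs_in_sets divide_ennreal)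
qed

end

theory Submission
  imports Defs "HOL-Real_Asymp.Real_Asymp"
begin

text \<open>
  Write \<open>y = x\<^sub>2 - \<lambda>\<close> for the height above the reference level. Along an elemental component
  \<open>cos \<beta> + B y\<^sup>2 / 2\<close> is conserved, so \<open>y\<^sup>2\<close> varies by at most \<open>4 / B\<close>. A component with an
  end at height of order \<open>h\<close> therefore has curvature of order at least \<open>B h\<close> throughout, and
  since its angle stays in \<open>{-pi..pi}\<close> its length is \<open>O(1 / (B h))\<close> (\<open>elemental_short\<close>). Hence
  far from the reference level an interface only joins grains whose centres are at distance at
  most \<open>r = 2 R + O(1 / (B h))\<close>, and \<open>r\<close> is much smaller than \<open>1 / sqrt B\<close>.

  Let \<open>a\<close> be a connected grain with \<open>\<bar>y\<bar> \<ge> h\<close> and follow the interface from \<open>a\<close> in either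
  direction. If \<open>a\<close> does not belong to a group of three distinct grains within \<open>2 r\<close> of \<open>a\<close>, the
  interface can only go back and forth between \<open>a\<close> and neighbours within \<open>r\<close> of \<open>a\<close>, so it stays
  at height at least \<open>h - r\<close>. It then reaches both walls within \<open>2 r\<close> of \<open>a\<close>, which is absurd since
  \<open>4 r < L\<close>. So some three grains are clustered at scale \<open>2 r\<close> (\<open>high_imp_clustered\<close>).

  For independent uniform grains of density \<open>\<nu>\<close> the expected number of such triples is of order
  \<open>L\<^sup>2 r\<^sup>4\<close>: one grain is anywhere, the two others are in a disc of area of order \<open>r\<^sup>2\<close> around it
  (\<open>outer_measure_clustered_le\<close>). Finally
  \<open>L\<^sup>2 r\<^sup>4 = (L / (sqrt B * ln B))\<^sup>2 * ((ln B)\<^sup>2 / B) * (sqrt B * r)\<^sup>4\<close>, and all three factors tend to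
  \<open>0\<close>. Pairs would not do: their expected number is of order \<open>L\<^sup>2 r\<^sup>2\<close>, which need not tend to \<open>0\<close>.
\<close>

section \<open>Clusters in a uniform configuration\<close>

definition clustered :: "nat \<Rightarrow> real \<Rightarrow> nat \<Rightarrow> config \<Rightarrow> bool" where
  "clustered m \<rho> N \<omega> \<longleftrightarrow>
     (\<exists>K\<subseteq>{..<N}. card K = m \<and> (\<exists>a\<in>K. \<forall>k\<in>K. dist (\<omega> k) (\<omega> a) \<le> \<rho>))"

lemma container_borel: "container L \<in> sets borel"
  by (simp add: container_def borel_closed closed_Times)

lemma emeasure_square:
  assumes "s \<ge> 0"
  shows "emeasure lborel (cbox (a, b) (a + s, b + s) :: point set) = ennreal (s\<^sup>2)"
  using assms
  by (subst emeasure_lborel_cbox) (auto simp: Basis_prod_def prod.union_disjoint power2_eq_square)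

lemma emeasure_container:
  assumes "L > 0"
  shows "emeasure lborel (container L) = ennreal (L\<^sup>2)"
proof -
  have "container L = cbox (0, 0) (0 + L, 0 + L)"
    by (auto simp: container_def cbox_Pair_eq)
  with assms show ?thesis
    by (simp only: emeasure_square)
qed

definition grains_in :: "nat \<Rightarrow> real \<Rightarrow> nat set \<Rightarrow> point set \<Rightarrow> config set" where
  "grains_in N L K A = (\<Pi>\<^sub>E k\<in>{..<N}. if k \<in> K then A \<inter> container L else container L)"

lemma grains_in_sets:
  assumes "A \<in> sets borel"
  shows "grains_in N L K A \<in> sets (config_measure N L)"
  using assms container_borel
  by (auto simp: grains_in_def config_measure_def intro!: sets_PiM_I_finite)

lemma emeasure_grains_in_le:
  assumes L: "L > 0" and K: "K \<subseteq> {..<N}" and A: "A \<in> sets borel"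
    and s: "emeasure lborel A \<le> ennreal s" "s \<ge> 0"
  shows "emeasure (config_measure N L) (grains_in N L K A) \<le> ennreal ((s / L\<^sup>2) ^ card K)"
proof -
  interpret product_sigma_finite "\<lambda>_::nat. lborel :: point measure"
    by standard
  let ?P = "\<Pi>\<^sub>M j\<in>{..<N}. (lborel :: point measure)"
  note C = container_borel[of L]
  have card: "card K \<le> N"
    using card_mono[OF _ K] by simp
  have "emeasure ?P (configs N L) = (\<Prod>k<N. emeasure lborel (container L))"
    unfolding configs_def using C by (subst emeasure_PiM) auto
  then have total: "emeasure ?P (configs N L) = ennreal ((L\<^sup>2) ^ N)"
    using L by (simp add: emeasure_container ennreal_power)
  have sets: "grains_in N L K A \<in> sets ?P"
    using grains_in_sets[OF A] by (simp add: config_measure_def)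
  have "emeasure ?P (grains_in N L K A)
      = (\<Prod>k<N. emeasure lborel (if k \<in> K then A \<inter> container L else container L))"
    unfolding grains_in_def using A C by (subst emeasure_PiM) auto
  also have "\<dots> \<le> (\<Prod>k<N. if k \<in> K then ennreal s else ennreal (L\<^sup>2))"
  proof (rule prod_mono_ennreal)
    fix k
    have "emeasure lborel (A \<inter> container L) \<le> ennreal s"
      using s A by (intro order.trans[OF emeasure_mono s(1)]) auto
    then show "emeasure lborel (if k \<in> K then A \<inter> container L else container L)
        \<le> (if k \<in> K then ennreal s else ennreal (L\<^sup>2))"
      using L by (simp add: emeasure_container)
  qed
  also have "\<dots> = (\<Prod>k\<in>K. ennreal s) * (\<Prod>k\<in>{..<N} - K. ennreal (L\<^sup>2))"
    using K by (subst prod.If_cases) (auto simp: Int_absorb1 Int_absorb2 Diff_eq)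
  also have "\<dots> = ennreal (s ^ card K * (L\<^sup>2) ^ (N - card K))"
    using K s by (simp add: card_Diff_subset finite_subset ennreal_power ennreal_mult)
  finally have le: "emeasure ?P (grains_in N L K A) \<le> \<dots>" .
  have "grains_in N L K A \<subseteq> configs N L"
    unfolding grains_in_def configs_def by (intro PiE_mono) auto
  then have "configs N L \<inter> grains_in N L K A = grains_in N L K A"
    by blast
  then have "emeasure (config_measure N L) (grains_in N L K A)
      = emeasure ?P (grains_in N L K A) / ennreal ((L\<^sup>2) ^ N)"
    using sets by (simp add: config_measure_def configs_in_sets total)
  also have "\<dots> \<le> ennreal (s ^ card K * (L\<^sup>2) ^ (N - card K)) / ennreal ((L\<^sup>2) ^ N)"
    by (rule divide_right_mono_ennreal[OF le])
  also have "\<dots> = ennreal (s ^ card K * (L\<^sup>2) ^ (N - card K) / (L\<^sup>2) ^ N)"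
    using L s by (simp add: divide_ennreal)
  also have "s ^ card K * (L\<^sup>2) ^ (N - card K) / (L\<^sup>2) ^ N = (s / L\<^sup>2) ^ card K"
    using L card by (simp add: power_diff power_divide)
  finally show ?thesis .
qed

text \<open>
  A union bound over a grid of about \<open>(L / \<rho>)\<^sup>2\<close> squares of side \<open>\<rho>\<close>: a cluster around \<open>a\<close> lies
  in the concentric square of side \<open>3 \<rho>\<close> around the grid square that contains \<open>a\<close>. A given
  \<open>m\<close>-set of grains lies in it with probability at most \<open>(9 \<rho>\<^sup>2 / L\<^sup>2) ^ m\<close>, and there are at most
  \<open>N ^ m\<close> such sets.
\<close>

lemma outer_measure_clustered_le:
  assumes L: "L > 0" and \<rho>: "0 < \<rho>" "\<rho> \<le> L"
  shows "outer_measure_of (config_measure N L) {\<omega> \<in> configs N L. clustered m \<rho> N \<omega>}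
    \<le> ennreal (4 * L\<^sup>2 / \<rho>\<^sup>2 * (9 * real N * \<rho>\<^sup>2 / L\<^sup>2) ^ m)"
proof -
  define M where "M = nat \<lfloor>L / \<rho>\<rfloor> + 1"
  define cell :: "nat \<times> nat \<Rightarrow> point set" where
    "cell z = cbox ((real (fst z) - 1) * \<rho>, (real (snd z) - 1) * \<rho>)
       ((real (fst z) - 1) * \<rho> + 3 * \<rho>, (real (snd z) - 1) * \<rho> + 3 * \<rho>)" for z
  define \<K> where "\<K> = {K. K \<subseteq> {..<N} \<and> card K = m}"
  define U where "U = (\<Union>(K, z)\<in>\<K> \<times> ({..<M} \<times> {..<M}). grains_in N L K (cell z))"
  have fin: "finite \<K>"
    unfolding \<K>_def by (rule finite_subset[of _ "Pow {..<N}"]) auto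
  have card: "real (card \<K>) \<le> real N ^ m"
  proof -
    have "card \<K> = N choose m"
      unfolding \<K>_def using n_subsets[of "{..<N}" m] by simp
    moreover have "N choose m \<le> N ^ m"
      by (cases "m \<le> N") (auto intro: binomial_le_pow simp: binomial_eq_0)
    ultimately show ?thesis
      by (metis of_nat_le_iff of_nat_power)
  qed
  have "real M \<le> L / \<rho> + 1"
    using L \<rho> unfolding M_def by simp
  also have "\<dots> \<le> 2 * (L / \<rho>)"
    using \<rho> by (simp add: field_simps)
  finally have M: "(real M)\<^sup>2 \<le> 4 * L\<^sup>2 / \<rho>\<^sup>2"
    using power_mono[of "real M" "2 * (L / \<rho>)" 2] by (simp add: power_mult_distrib power_divide)
  \<comment> \<open>coordinate \<open>x\<close> sits in column \<open>\<lfloor>x / \<rho>\<rfloor>\<close>, its \<open>\<rho>\<close>-neighbours at most one column away\<close>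
  have column: "\<exists>p<M. \<forall>y. \<bar>y - x\<bar> \<le> \<rho> \<longrightarrow> (real p - 1) * \<rho> \<le> y \<and> y \<le> (real p - 1) * \<rho> + 3 * \<rho>"
    if x: "0 \<le> x" "x \<le> L" for x
  proof (intro exI conjI allI impI)
    let ?p = "nat \<lfloor>x / \<rho>\<rfloor>"
    have q: "real ?p \<le> x / \<rho>" "x / \<rho> < real ?p + 1"
      using x \<rho> by auto
    then have p: "real ?p * \<rho> \<le> x" "x < (real ?p + 1) * \<rho>"
      using \<rho> by (simp_all add: field_simps)
    have "x / \<rho> \<le> L / \<rho>"
      using x \<rho> by (simp add: divide_right_mono)
    then show "?p < M"
      unfolding M_def by (metis floor_mono nat_mono less_Suc_eq_le Suc_eq_plus1)
    fix y assume "\<bar>y - x\<bar> \<le> \<rho>"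
    with p show "(real ?p - 1) * \<rho> \<le> y" "y \<le> (real ?p - 1) * \<rho> + 3 * \<rho>"
      by (simp_all add: algebra_simps abs_le_iff)
  qed
  have "{\<omega> \<in> configs N L. clustered m \<rho> N \<omega>} \<subseteq> U"
  proof safe
    fix \<omega> assume \<omega>: "\<omega> \<in> configs N L" and "clustered m \<rho> N \<omega>"
    then obtain K a where K: "K \<in> \<K>" "a \<in> K" "K \<subseteq> {..<N}"
      and near: "\<And>k. k \<in> K \<Longrightarrow> dist (\<omega> k) (\<omega> a) \<le> \<rho>"
      unfolding clustered_def \<K>_def by blast
    have in_container: "\<omega> k \<in> container L" if "k < N" for k
      using \<omega> that by (auto simp: configs_def)
    then have "\<omega> a \<in> container L"
      using K by auto
    then obtain p q where pq: "p < M" "q < M"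
      and p: "\<And>y. \<bar>y - fst (\<omega> a)\<bar> \<le> \<rho> \<Longrightarrow>
            (real p - 1) * \<rho> \<le> y \<and> y \<le> (real p - 1) * \<rho> + 3 * \<rho>"
      and q: "\<And>y. \<bar>y - snd (\<omega> a)\<bar> \<le> \<rho> \<Longrightarrow>
            (real q - 1) * \<rho> \<le> y \<and> y \<le> (real q - 1) * \<rho> + 3 * \<rho>"
      using column[of "fst (\<omega> a)"] column[of "snd (\<omega> a)"] by (auto simp: container_def)
    have "\<omega> k \<in> cell (p, q)" if "k \<in> K" for k
    proof -
      have "\<bar>fst (\<omega> k) - fst (\<omega> a)\<bar> \<le> \<rho>" "\<bar>snd (\<omega> k) - snd (\<omega> a)\<bar> \<le> \<rho>"
        using near[OF that] dist_fst_le[of "\<omega> k" "\<omega> a"] dist_snd_le[of "\<omega> k" "\<omega> a"]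
        by (auto simp: dist_real_def)
      then show ?thesis
        using p q unfolding cell_def by (cases "\<omega> k") (auto simp: cbox_Pair_eq)
    qed
    then have "\<omega> \<in> grains_in N L K (cell (p, q))"
      using \<omega> in_container by (auto simp: grains_in_def configs_def PiE_iff)
    then show "\<omega> \<in> U"
      using K pq unfolding U_def by blast
  qed
  moreover have "U \<in> sets (config_measure N L)"
    unfolding U_def using fin by (auto intro!: grains_in_sets simp: cell_def)
  ultimately have "outer_measure_of (config_measure N L) {\<omega> \<in> configs N L. clustered m \<rho> N \<omega>}
      \<le> emeasure (config_measure N L) U"
    by (metis outer_measure_of_mono outer_measure_of_eq)
  also have "\<dots> \<le> (\<Sum>Kz\<in>\<K> \<times> ({..<M} \<times> {..<M}).
      emeasure (config_measure N L) (case Kz of (K, z) \<Rightarrow> grains_in N L K (cell z)))"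
    unfolding U_def using fin
    by (intro emeasure_subadditive_finite) (auto intro!: grains_in_sets simp: cell_def)
  also have "\<dots> \<le> (\<Sum>Kz\<in>\<K> \<times> ({..<M} \<times> {..<M}). ennreal (((3 * \<rho>)\<^sup>2 / L\<^sup>2) ^ m))"
  proof (rule sum_mono, clarify)
    fix K p q assume "K \<in> \<K>"
    moreover have "emeasure lborel (cell (p, q)) = ennreal ((3 * \<rho>)\<^sup>2)"
      unfolding cell_def using \<rho> by (intro emeasure_square) auto
    ultimately show "emeasure (config_measure N L) (grains_in N L K (cell (p, q)))
        \<le> ennreal (((3 * \<rho>)\<^sup>2 / L\<^sup>2) ^ m)"
      using emeasure_grains_in_le[OF L, of K N "cell (p, q)" "(3 * \<rho>)\<^sup>2"]
      by (auto simp: \<K>_def cell_def)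
  qed
  also have "\<dots> = ennreal (real (card \<K>) * (real M)\<^sup>2 * (9 * \<rho>\<^sup>2 / L\<^sup>2) ^ m)"
    by (simp add: card_cartesian_product ennreal_of_nat_eq_real_of_nat ennreal_mult'
        power2_eq_square ac_simps)
  also have "\<dots> \<le> ennreal (real N ^ m * (4 * L\<^sup>2 / \<rho>\<^sup>2) * (9 * \<rho>\<^sup>2 / L\<^sup>2) ^ m)"
    using card M by (intro ennreal_leI mult_right_mono mult_mono) auto
  also have "real N ^ m * (4 * L\<^sup>2 / \<rho>\<^sup>2) * (9 * \<rho>\<^sup>2 / L\<^sup>2) ^ m
      = 4 * L\<^sup>2 / \<rho>\<^sup>2 * (9 * real N * \<rho>\<^sup>2 / L\<^sup>2) ^ m"
    by (simp add: power_mult_distrib power_divide)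
  finally show ?thesis .
qed

section \<open>Elemental components far from the reference level\<close>

text \<open>
  The derivative of \<open>cos \<beta>\<close> along the curve is \<open>- sin \<beta> * B y\<close>, and \<open>sin \<beta>\<close> is the derivative
  of \<open>y\<close>.
\<close>

lemma elemental_first_integral:
  assumes c: "is_elemental B R L \<alpha> N \<omega> lam c"
    and s: "s \<in> {0..arc_length c}" "t \<in> {0..arc_length c}"
  shows "cos (angle c s) + B / 2 * (snd (curve c s) - lam)\<^sup>2
    = cos (angle c t) + B / 2 * (snd (curve c t) - lam)\<^sup>2"
proof -
  let ?S = "{0..arc_length c}"
  let ?F = "\<lambda>s. cos (angle c s) + B / 2 * (snd (curve c s) - lam)\<^sup>2"
  have "(?F has_field_derivative 0) (at u within ?S)" if "u \<in> ?S" for u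
  proof -
    have curve: "(curve c has_vector_derivative unit_vec (angle c u)) (at u within ?S)"
      and angle: "(angle c has_field_derivative B * (snd (curve c u) - lam)) (at u within ?S)"
      using c that by (auto simp: is_elemental_def)
    have "((\<lambda>s. snd (curve c s)) has_vector_derivative snd (unit_vec (angle c u)))
        (at u within ?S)"
      by (rule bounded_linear.has_vector_derivative[OF bounded_linear_snd curve])
    then have "((\<lambda>s. snd (curve c s)) has_field_derivative sin (angle c u)) (at u within ?S)"
      by (simp add: unit_vec_def has_real_derivative_iff_has_vector_derivative)
    from this angle show ?thesis
      by (auto intro!: derivative_eq_intros)
  qed
  then have "\<exists>k. \<forall>u\<in>?S. ?F u = k"
    by (intro has_field_derivative_zero_constant) auto
  with s show ?thesis
    by auto
qed

text \<open>
  By the first integral, \<open>y\<^sup>2\<close> differs from its value at \<open>s\<close> by at most \<open>4 / B\<close>, hence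
  \<open>\<bar>y\<bar> \<ge> H / 2\<close> on the whole component: this needs \<open>H\<^sup>2 - 4 / B \<ge> H\<^sup>2 / 4\<close>, which is
  \<open>B * H\<^sup>2 \<ge> 16 / 3\<close>. The angle then turns at rate at least \<open>B H / 2\<close>, but by no more than
  \<open>2 pi\<close> in total.
\<close>

lemma elemental_short:
  assumes c: "is_elemental B R L \<alpha> N \<omega> lam c"
    and B: "B > 0" and H: "H > 0" "B * H\<^sup>2 \<ge> 6"
    and s: "s \<in> {0..arc_length c}" and high: "\<bar>snd (curve c s) - lam\<bar> \<ge> H"
  shows "arc_length c \<le> 4 * pi / (B * H)"
proof -
  let ?S = "{0..arc_length c}"
  have len: "arc_length c > 0"
    using c by (simp add: is_elemental_def)
  have far: "\<bar>snd (curve c t) - lam\<bar> \<ge> H / 2" if t: "t \<in> ?S" for t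
  proof -
    let ?y = "snd (curve c t) - lam"
    have "B / 2 * H\<^sup>2 \<le> B / 2 * (snd (curve c s) - lam)\<^sup>2"
      using high H B by (intro mult_left_mono) (auto simp: power_mono abs_le_square_iff[symmetric])
    then have "B / 2 * H\<^sup>2 - 2 \<le> B / 2 * ?y\<^sup>2"
      using elemental_first_integral[OF c s t] cos_ge_minus_one[of "angle c s"]
        cos_le_one[of "angle c t"] by linarith
    then have "B * (H / 2)\<^sup>2 \<le> B * ?y\<^sup>2"
      using H by (simp add: power_divide)
    then have "(H / 2)\<^sup>2 \<le> ?y\<^sup>2"
      using B by simp
    then show ?thesis
      using H by (simp add: abs_le_square_iff[symmetric])
  qed
  have "(angle c has_real_derivative B * (snd (curve c t) - lam)) (at t within ?S)"
    if "t \<in> ?S" for t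
    using c that by (auto simp: is_elemental_def)
  then obtain t where t: "0 < t" "t < arc_length c"
    and mvt: "angle c (arc_length c) - angle c 0 = arc_length c * (B * (snd (curve c t) - lam))"
    using mvt_simple[of 0 "arc_length c" "angle c" "\<lambda>t. (*) (B * (snd (curve c t) - lam))"] len
    by (auto simp: has_field_derivative_def mult.commute)
  have "angle c (arc_length c) \<in> {-pi..pi}" "angle c 0 \<in> {-pi..pi}"
    using c len by (auto simp: is_elemental_def)
  then have "\<bar>arc_length c * (B * (snd (curve c t) - lam))\<bar> \<le> 2 * pi"
    unfolding mvt[symmetric] by auto
  moreover have "arc_length c * (B * (H / 2)) \<le> \<bar>arc_length c * (B * (snd (curve c t) - lam))\<bar>"
    using far[of t] t len B by (auto simp: abs_mult)
  ultimately show ?thesis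
    using B H by (simp add: field_simps)
qed

lemma elemental_dist_le:
  assumes c: "is_elemental B R L \<alpha> N \<omega> lam c"
  shows "dist (curve c 0) (curve c (arc_length c)) \<le> arc_length c"
proof -
  let ?S = "{0..arc_length c}"
  have len: "arc_length c > 0"
    using c by (simp add: is_elemental_def)
  have "norm (curve c (arc_length c) - curve c 0) \<le> 1 * norm (arc_length c - 0)"
  proof (rule differentiable_bound)
    show "convex ?S" by simp
    show "(curve c has_derivative (\<lambda>h. h *\<^sub>R unit_vec (angle c s))) (at s within ?S)"
      if "s \<in> ?S" for s
      using c that by (auto simp: is_elemental_def has_vector_derivative_def)
    show "onorm (\<lambda>h. h *\<^sub>R unit_vec (angle c s)) \<le> 1" if "s \<in> ?S" for s
    proof (rule onorm_le)
      have "norm (unit_vec (angle c s)) = 1"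
        by (simp add: unit_vec_def norm_Pair)
      then show "norm (h *\<^sub>R unit_vec (angle c s)) \<le> 1 * norm h" for h :: real
        by (simp only: norm_scaleR) simp
    qed
  qed (use len in auto)
  then show ?thesis
    using len by (simp add: dist_norm norm_minus_commute)
qed

section \<open>A high connected grain lies in a cluster\<close>

text \<open>
  A set of sites rather than of indices, so that the ends of a component can be tested for
  membership directly; a wall never belongs to it.
\<close>

definition sites_near :: "real \<Rightarrow> nat \<Rightarrow> config \<Rightarrow> nat \<Rightarrow> site set" where
  "sites_near r N \<omega> a = Grain ` {j. j < N \<and> dist (\<omega> j) (\<omega> a) \<le> r}"

text \<open>
  The inductive step along the interface, in either direction. The end of \<open>c\<close> on the site \<open>x\<close>
  has height at least \<open>h - r - R \<ge> h / 4\<close>, so \<open>c\<close> has length at most \<open>16 pi / (B h) = r - 2 R\<close>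
  and the next grain \<open>l\<close> is within \<open>r\<close> of the previous one \<open>j\<close>, thus within \<open>2 r\<close> of \<open>a\<close>. The
  radius does not grow to \<open>2 r\<close>, because otherwise \<open>a\<close>, \<open>j\<close> and \<open>l\<close> would be distinct and form
  a cluster. The constant \<open>96 = 6 * 4\<^sup>2\<close> comes from \<open>elemental_short\<close> at height \<open>h / 4\<close>.
\<close>

lemma elemental_stays_near:
  fixes h :: real
  assumes c: "is_elemental B R L \<alpha> N \<omega> lam c"
    and B: "B > 0" "B * h\<^sup>2 \<ge> 96" and h: "h > 0" and R: "0 \<le> R" "R \<le> h / 4"
    and r: "r = 2 * R + 16 * pi / (B * h)" "r \<le> h / 2"
    and a: "a < N" "\<bar>snd (\<omega> a) - lam\<bar> \<ge> h" and sparse: "\<not> clustered 3 (2 * r) N \<omega>"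
    and ends: "(x = source c \<and> y = target c) \<or> (x = target c \<and> y = source c)"
    and x: "x \<in> sites_near r N \<omega> a"
  shows "(case y of Grain l \<Rightarrow> y \<in> sites_near r N \<omega> a
    | Left_Wall \<Rightarrow> fst (\<omega> a) \<le> 2 * r | Right_Wall \<Rightarrow> fst (\<omega> a) \<ge> L - 2 * r)"
proof -
  obtain j where j: "x = Grain j" "j < N" "dist (\<omega> j) (\<omega> a) \<le> r"
    using x by (auto simp: sites_near_def)
  have len: "arc_length c > 0"
    using c by (simp add: is_elemental_def)
  obtain s t u v where st: "s \<in> {0..arc_length c}"
    "dist (curve c s) (curve c t) \<le> arc_length c"
    and cx: "contact R L \<alpha> N \<omega> x (curve c s) u" and cy: "contact R L \<alpha> N \<omega> y (curve c t) v"
    using ends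
  proof
    assume "x = source c \<and> y = target c"
    with c len elemental_dist_le[OF c] show ?thesis
      by (intro that[of 0 "arc_length c"]) (auto simp: is_elemental_def)
  next
    assume "x = target c \<and> y = source c"
    with c len elemental_dist_le[OF c] show ?thesis
      by (intro that[of "arc_length c" 0]) (auto simp: is_elemental_def dist_commute)
  qed
  have "x \<noteq> y"
    using c ends by (auto simp: is_elemental_def)
  have pj: "dist (curve c s) (\<omega> j) = R"
    using cx j by simp
  have "\<bar>snd (curve c s) - snd (\<omega> j)\<bar> \<le> h / 4" "\<bar>snd (\<omega> j) - snd (\<omega> a)\<bar> \<le> h / 2"
    using pj j R r dist_snd_le[of "curve c s" "\<omega> j"] dist_snd_le[of "\<omega> j" "\<omega> a"]
    by (auto simp: dist_real_def)
  then have "h / 4 \<le> \<bar>snd (curve c s) - lam\<bar>"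
    using a by linarith
  then have "arc_length c \<le> 4 * pi / (B * (h / 4))"
    using B h st by (intro elemental_short[OF c]) (auto simp: power_divide)
  then have "dist (curve c s) (curve c t) \<le> 16 * pi / (B * h)"
    using st by simp
  then have q: "dist (curve c t) (\<omega> j) \<le> r - R"
    using pj r dist_triangle[of "curve c t" "\<omega> j" "curve c s"] by (simp add: dist_commute)
  then have qa: "dist (curve c t) (\<omega> a) \<le> 2 * r - R"
    using j dist_triangle[of "curve c t" "\<omega> a" "\<omega> j"] by simp
  have r0: "r \<ge> 0"
    using j zero_le_dist order_trans by blast
  show ?thesis
  proof (cases y)
    case (Grain l)
    have l: "l < N" "dist (curve c t) (\<omega> l) = R"
      using cy Grain by auto
    then have lj: "dist (\<omega> l) (\<omega> j) \<le> r" and la: "dist (\<omega> l) (\<omega> a) \<le> 2 * r"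
      using q qa dist_triangle[of "\<omega> l" "\<omega> j" "curve c t"] dist_triangle[of "\<omega> l" "\<omega> a" "curve c t"]
      by (simp_all add: dist_commute)
    have "dist (\<omega> l) (\<omega> a) \<le> r"
    proof (rule ccontr)
      assume "\<not> dist (\<omega> l) (\<omega> a) \<le> r"
      then have "l \<noteq> a" "j \<noteq> a" "l \<noteq> j"
        using lj r0 j by auto
      then have "clustered 3 (2 * r) N \<omega>"
        using j la l a r0 unfolding clustered_def
        by (intro exI[of _ "{a, j, l}"] conjI bexI[of _ a]) auto
      with sparse show False ..
    qed
    with l Grain show ?thesis
      by (simp add: sites_near_def)
  next
    case Left_Wall
    then show ?thesis
      using cy qa R dist_fst_le[of "curve c t" "\<omega> a"] by (auto simp: dist_real_def)
  next
    case Right_Wall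
    then show ?thesis
      using cy qa R dist_fst_le[of "curve c t" "\<omega> a"] by (auto simp: dist_real_def)
  qed
qed

text \<open>
  Without a cluster around \<open>a\<close>, every component after \<open>a\<close> starts near \<open>a\<close> and every component
  before \<open>a\<close> ends near \<open>a\<close>; so both walls are within \<open>2 r\<close> of \<open>a\<close>, although they are \<open>L\<close> apart.
\<close>

lemma high_imp_clustered:
  fixes h :: real
  assumes \<Gamma>: "is_interface B R L \<alpha> N \<omega> lam \<Gamma>"
    and B: "B > 0" "B * h\<^sup>2 \<ge> 96" and h: "h > 0" and R: "0 \<le> R" "R \<le> h / 4"
    and r: "r = 2 * R + 16 * pi / (B * h)" "r \<le> h / 2" "4 * r < L"
    and a: "a \<in> connected_grains \<Gamma>" "\<bar>snd (\<omega> a) - lam\<bar> \<ge> h"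
  shows "clustered 3 (2 * r) N \<omega>"
proof (rule ccontr)
  assume sparse: "\<not> clustered 3 (2 * r) N \<omega>"
  define ps where "ps = pieces \<Gamma>"
  define n where "n = length ps"
  have n: "n > 0"
    and el: "\<And>i. i < n \<Longrightarrow> is_elemental B R L \<alpha> N \<omega> lam (ps ! i)"
    and first: "source (ps ! 0) = Left_Wall"
    and last: "target (ps ! (n - 1)) = Right_Wall"
    and link: "\<And>i. Suc i < n \<Longrightarrow> \<exists>j. target (ps ! i) = Grain j \<and> source (ps ! Suc i) = Grain j"
    using \<Gamma> by (auto simp: is_interface_def ps_def n_def hd_conv_nth last_conv_nth
        successively_conv_nth)
  let ?S = "sites_near r N \<omega> a"
  obtain k where k: "k < n" "source (ps ! k) = Grain a \<or> target (ps ! k) = Grain a"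
    using a by (auto simp: connected_grains_def ps_def n_def in_set_conv_nth)
  have aN: "a < N"
    using el[OF k(1)] k(2) by (auto simp: is_elemental_def)
  have r0: "r \<ge> 0"
    using R B h r by simp
  have aS: "Grain a \<in> ?S"
    using aN r0 by (simp add: sites_near_def)
  note stays = elemental_stays_near[OF _ B h R r(1,2) aN a(2) sparse]
  have forward: "source (ps ! i) \<in> ?S" if "source (ps ! k') \<in> ?S" "k' \<le> i" "i < n" for k' i
    using that(2,3)
  proof (induction i rule: dec_induct)
    case (step i)
    then obtain j where "target (ps ! i) = Grain j" "source (ps ! Suc i) = Grain j"
      using link[of i] by auto
    with step show ?case
      using stays[OF el[of i], of "source (ps ! i)" "target (ps ! i)"] by simp
  qed (use that in simp)
  have backward: "target (ps ! i) \<in> ?S"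
    if k': "target (ps ! k') \<in> ?S" "i \<le> k'" "k' < n" for k' i
    using k'(2)
  proof (induction i rule: inc_induct)
    case (step i)
    then obtain j where "target (ps ! i) = Grain j" "source (ps ! Suc i) = Grain j"
      using link[of i] k'(3) by auto
    with step show ?case
      using stays[OF el[of "Suc i"], of "target (ps ! Suc i)" "source (ps ! Suc i)"] k'(3) by simp
  qed (use k' in simp)
  \<comment> \<open>\<open>a\<close> is the end of one component and the start of the next, since walls occur at the ends only\<close>
  obtain i j where ij: "i < n" "source (ps ! i) = Grain a" "j < n" "target (ps ! j) = Grain a"
    using k(2)
  proof
    assume "source (ps ! k) = Grain a"
    moreover from this first obtain k' where "k = Suc k'"
      by (cases k) auto
    ultimately show ?thesis
      using link[of k'] k that[of k k'] by auto
  next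
    assume t: "target (ps ! k) = Grain a"
    with last have "k \<noteq> n - 1"
      by auto
    then show ?thesis
      using link[of k] k t that[of "Suc k" k] by fastforce
  qed
  have "source (ps ! (n - 1)) \<in> ?S"
    using forward[of i "n - 1"] ij aS by auto
  then have "fst (\<omega> a) \<ge> L - 2 * r"
    using stays[OF el[of "n - 1"], of "source (ps ! (n - 1))" Right_Wall] last n by auto
  moreover have "target (ps ! 0) \<in> ?S"
    using backward[of j 0] ij aS by auto
  then have "fst (\<omega> a) \<le> 2 * r"
    using stays[OF el[of 0], of "target (ps ! 0)" Left_Wall] first n by auto
  ultimately show False
    using r by linarith
qed

section \<open>High interfaces are asymptotically improbable\<close>

theorem theorem3p10:
  fixes \<nu> \<alpha> v0 h :: real
    and R L :: "real \<Rightarrow> real"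
    and N :: "real \<Rightarrow> nat"
    and v1 :: "real \<Rightarrow> config \<Rightarrow> interface \<Rightarrow> real"
  assumes "\<nu> > 0" and "\<alpha> \<in> {-pi/2..pi/2}" and "v0 \<in> {0..1}" and "h > 0"
    and "\<And>B. B > 0 \<Longrightarrow> R B \<in> {0<..<1/2}"
    and "\<And>B. B > 0 \<Longrightarrow> L B > 0"
    and "\<And>B. B > 0 \<Longrightarrow> N B > 0 \<and> real (N B) = \<nu> * (L B)\<^sup>2"
    and "\<And>B \<omega> \<Gamma>. B > 0 \<Longrightarrow> v1 B \<omega> \<Gamma> \<in> {0..1}"
    and "volume_balance R L \<alpha> N v0 v1"
    and "(R \<longlongrightarrow> 0) at_top"
    and "((\<lambda>B. R B / (1 / sqrt B)) \<longlongrightarrow> 0) at_top"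
    and "((\<lambda>B. sqrt B / L B) \<longlongrightarrow> 0) at_top"
    and "((\<lambda>B. L B / (sqrt B * ln B)) \<longlongrightarrow> 0) at_top"
  shows "((\<lambda>B. outer_measure_of (config_measure (N B) (L B))
            (high_configs B (R B) (L B) \<alpha> (N B) (v1 B) h)) \<longlongrightarrow> 0) at_top"
proof -
  note h = \<open>h > 0\<close>
  define r where "r B = 2 * R B + 16 * pi / (B * h)" for B
  \<comment> \<open>the bound of \<open>outer_measure_clustered_le\<close> for triples at scale \<open>2 * r B\<close>, with \<open>N = \<nu> L\<^sup>2\<close>\<close>
  define P where "P B = 4 * (L B)\<^sup>2 / (2 * r B)\<^sup>2 * (9 * \<nu> * (2 * r B)\<^sup>2) ^ 3" for B
  have scaled: "((\<lambda>B. sqrt B * r B) \<longlongrightarrow> 0) at_top"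
  proof -
    have "((\<lambda>B. sqrt B * (16 * pi / (B * h))) \<longlongrightarrow> 0) at_top"
      using h by real_asymp
    from tendsto_add[OF tendsto_mult_left[OF assms(11), of 2] this] show ?thesis
      by (simp add: r_def algebra_simps)
  qed
  have r0: "(r \<longlongrightarrow> 0) at_top"
  proof -
    have "((\<lambda>B. 16 * pi / (B * h)) \<longlongrightarrow> 0) at_top"
      using h by real_asymp
    from tendsto_add[OF tendsto_mult_left[OF assms(10), of 2] this] show ?thesis
      by (simp add: r_def[abs_def])
  qed
  have P0: "(P \<longlongrightarrow> 0) at_top"
  proof -
    \<comment> \<open>\<open>46656 = 9 ^ 3 * 4 ^ 3\<close>; the constant factor \<open>4\<close> cancels in \<open>4 * L\<^sup>2 / (2 * r)\<^sup>2\<close>\<close>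
    have log: "((\<lambda>B::real. (ln B)\<^sup>2 / B) \<longlongrightarrow> 0) at_top"
      by real_asymp
    have "((\<lambda>B. 46656 * \<nu> ^ 3 * (L B / (sqrt B * ln B))\<^sup>2 * ((ln B)\<^sup>2 / B) * (sqrt B * r B) ^ 4)
        \<longlongrightarrow> 46656 * \<nu> ^ 3 * 0\<^sup>2 * 0 * 0 ^ 4) at_top"
      by (intro tendsto_intros assms log scaled)
    moreover have "\<forall>\<^sub>F B in at_top. 46656 * \<nu> ^ 3 * (L B / (sqrt B * ln B))\<^sup>2 * ((ln B)\<^sup>2 / B)
        * (sqrt B * r B) ^ 4 = P B"
      using eventually_gt_at_top[of 1]
    proof eventually_elim
      case (elim B)
      have s4: "sqrt B ^ 4 = B\<^sup>2" "sqrt B ^ 2 = B"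
        using elim power_mult[of "sqrt B" 2 2] by simp_all
      have r: "r B > 0"
        using assms(5)[of B] elim h by (auto simp: r_def intro!: add_pos_pos)
      have "(L B / (sqrt B * ln B))\<^sup>2 * ((ln B)\<^sup>2 / B) = (L B)\<^sup>2 / B\<^sup>2"
        using elim by (simp add: power_divide power_mult_distrib power2_eq_square[of B])
      then have "46656 * \<nu> ^ 3 * (L B / (sqrt B * ln B))\<^sup>2 * ((ln B)\<^sup>2 / B) * (sqrt B * r B) ^ 4
          = 46656 * \<nu> ^ 3 * ((L B)\<^sup>2 / B\<^sup>2) * (B\<^sup>2 * r B ^ 4)"
        by (simp only: mult.assoc power_mult_distrib s4)
      also have "\<dots> = 46656 * \<nu> ^ 3 * (L B)\<^sup>2 * r B ^ 4"
        using elim by simp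
      also have "\<dots> = P B"
        using r by (simp add: P_def power_mult_distrib power_numeral_reduce)
      finally show ?case .
    qed
    ultimately show ?thesis
      by (subst (asm) tendsto_cong) auto
  qed
  have "\<forall>\<^sub>F B in at_top. sqrt B / L B < 1"
    using assms(12) by (rule order_tendstoD) simp
  moreover have "\<forall>\<^sub>F B in at_top. R B < h / 4"
    using assms(10) by (rule order_tendstoD) (use h in simp)
  moreover have "\<forall>\<^sub>F B in at_top. r B < min (h / 2) (1 / 4)"
    using r0 by (rule order_tendstoD) (use h in simp)
  moreover have "\<forall>\<^sub>F B in at_top. B > max 1 (96 / h\<^sup>2)"
    by (rule eventually_gt_at_top)
  ultimately have "\<forall>\<^sub>F B in at_top. outer_measure_of (config_measure (N B) (L B))
      (high_configs B (R B) (L B) \<alpha> (N B) (v1 B) h) \<le> ennreal (P B)"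
  proof eventually_elim
    case (elim B)
    have B: "B > 1" "B * h\<^sup>2 \<ge> 96"
      using elim h by (auto simp: field_simps)
    have L: "L B > 1"
    proof -
      have "sqrt B < L B"
        using elim assms(6)[of B] B by (simp add: field_simps)
      then show ?thesis
        using B real_sqrt_gt_1_iff[of B] by linarith
    qed
    have R: "0 < R B" "R B \<le> h / 4"
      using assms(5)[of B] elim B by auto
    have r: "0 < r B" "r B \<le> h / 2" "4 * r B < L B"
      using R B h elim L by (auto simp: r_def intro!: add_pos_pos)
    have "high_configs B (R B) (L B) \<alpha> (N B) (v1 B) h
        \<subseteq> {\<omega> \<in> configs (N B) (L B). clustered 3 (2 * r B) (N B) \<omega>}"
    proof
      fix \<omega> assume "\<omega> \<in> high_configs B (R B) (L B) \<alpha> (N B) (v1 B) h"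
      then obtain \<Gamma> where \<omega>: "\<omega> \<in> configs (N B) (L B)"
        and \<Gamma>: "is_interface B (R B) (L B) \<alpha> (N B) \<omega> (v1 B \<omega> \<Gamma> * L B) \<Gamma>"
        and ne: "connected_grains \<Gamma> \<noteq> {}"
        and max: "Max ((\<lambda>j. \<bar>snd (\<omega> j) - v1 B \<omega> \<Gamma> * L B\<bar>) ` connected_grains \<Gamma>) \<ge> h"
        by (auto simp: high_configs_def)
      have "connected_grains \<Gamma> \<subseteq> (\<lambda>c. case source c of Grain j \<Rightarrow> j) ` set (pieces \<Gamma>)
          \<union> (\<lambda>c. case target c of Grain j \<Rightarrow> j) ` set (pieces \<Gamma>)"
        unfolding connected_grains_def by (force simp: image_iff)
      then have "finite (connected_grains \<Gamma>)"
        by (rule finite_subset) simp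
      then obtain a where "a \<in> connected_grains \<Gamma>" "\<bar>snd (\<omega> a) - v1 B \<omega> \<Gamma> * L B\<bar> \<ge> h"
        using max ne by (auto simp: Max_ge_iff)
      then have "clustered 3 (2 * r B) (N B) \<omega>"
        using high_imp_clustered[OF \<Gamma> _ B(2) h _ R(2) r_def r(2,3)] B R by simp
      with \<omega> show "\<omega> \<in> {\<omega> \<in> configs (N B) (L B). clustered 3 (2 * r B) (N B) \<omega>}"
        by simp
    qed
    then have "outer_measure_of (config_measure (N B) (L B))
          (high_configs B (R B) (L B) \<alpha> (N B) (v1 B) h)
        \<le> outer_measure_of (config_measure (N B) (L B))
            {\<omega> \<in> configs (N B) (L B). clustered 3 (2 * r B) (N B) \<omega>}"
      by (rule outer_measure_of_mono)
    also have "\<dots> \<le> ennreal (4 * (L B)\<^sup>2 / (2 * r B)\<^sup>2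
        * (9 * real (N B) * (2 * r B)\<^sup>2 / (L B)\<^sup>2) ^ 3)"
      using r L by (intro outer_measure_clustered_le) auto
    also have "9 * real (N B) * (2 * r B)\<^sup>2 / (L B)\<^sup>2 = 9 * \<nu> * (2 * r B)\<^sup>2"
      using assms(7)[of B] B L by simp
    finally show ?case
      by (simp add: P_def)
  qed
  moreover have "((\<lambda>B. ennreal (P B)) \<longlongrightarrow> 0) at_top"
    using tendsto_ennrealI[OF P0] by simp
  ultimately show ?thesis
    by - (rule tendsto_sandwich[where f = "\<lambda>_. 0" and h = "\<lambda>B. ennreal (P B)"], simp_all)
qed

end
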